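(* Let $\sigma>0$, $\alpha>0$, $0\leqslant\rho\leqslant1$, $\boldsymbol{\theta}=(\sigma,\alpha,\rho)^\top$, let $W\sim{\rm UF}(\boldsymbol{\theta})$, and let $Y$ be a positive random variable with CDF $$G(x;\rho)=\frac{x}{x+1}\cdot\frac{(x+1)^2-\rho}{(x+1)^2-\rho x},\qquad x>0.$$ Then $$W\stackrel{d}{=}\frac{\sigma Y^{1/\alpha}}{1+\sigma Y^{1/\alpha}}\qquad\text{and}\qquad Y\stackrel{d}{=}\left[\frac{W}{\sigma(1-W)}\right]^\alpha,$$ where $\stackrel{d}{=}$ denotes equality in distribution.
   Context: For $\boldsymbol{\theta}=(\sigma,\alpha,\rho)^\top$ with $\sigma>0$, $\alpha>0$, $0\leqslant\rho\leqslant1$, the unit-Fréchet distribution ${\rm UF}(\boldsymbol{\theta})$ is the distribution on $(0,1)$ with CDF, for $0<w<1$, $$F_W(w;\boldsymbol{\theta})=\frac{\frac{s^\alpha}{\sigma^\alpha}}{\frac{s^\alpha}{\sigma^\alpha}+1}\cdot\frac{\left(\frac{s^\alpha}{\sigma^\alpha}+1\right)^2-\rho}{\left(\frac{s^\alpha}{\sigma^\alpha}+1\right)^2-\rho\,\frac{s^\alpha}{\sigma^\alpha}},\qquad s=\frac{w}{1-w}.$$ *)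

theory Defs
  imports "HOL-Probability.Probability"
begin

definition UF_cdf :: "real \<Rightarrow> real \<Rightarrow> real \<Rightarrow> real \<Rightarrow> real" where
  "UF_cdf \<sigma> \<alpha> \<rho> w =
    (let s = w / (1 - w); t = s powr \<alpha> / \<sigma> powr \<alpha>
     in t / (t + 1) * (((t + 1)\<^sup>2 - \<rho>) / ((t + 1)\<^sup>2 - \<rho> * t)))"

text \<open>The formula is only meant for arguments strictly between 0 and 1; that the
  distribution lives on this interval is recorded by the almost-everywhere condition.\<close>

definition UF_distribution :: "real \<Rightarrow> real \<Rightarrow> real \<Rightarrow> real measure \<Rightarrow> bool" where
  "UF_distribution \<sigma> \<alpha> \<rho> D \<longleftrightarrow>
     real_distribution D \<and>
     (AE w in D. 0 < w \<and> w < 1) \<and>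
     (\<forall>w. 0 < w \<and> w < 1 \<longrightarrow> cdf D w = UF_cdf \<sigma> \<alpha> \<rho> w)"

definition G_cdf :: "real \<Rightarrow> real \<Rightarrow> real" where
  "G_cdf \<rho> x = x / (x + 1) * (((x + 1)\<^sup>2 - \<rho>) / ((x + 1)\<^sup>2 - \<rho> * x))"

end

theory Submission
  imports Defs
begin

text \<open>The map h(y) = \<sigma> y^(1/\<alpha>) / (1 + \<sigma> y^(1/\<alpha>)) is an increasing
  bijection from the positive reals onto (0,1), with inverse g(w) = (w / (\<sigma> (1 -
  w)))^\<alpha>. The unit-Frechet CDF is G composed with g (\<open>UF_cdf_eq_G_cdf\<close>), so for
  0 < w < 1 monotonicity (\<open>transform_le_iff\<close>) gives P(W \<le> w) = G(g(w)) = P(Y \<le>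
  g(w)) = P(h(Y) \<le> w). Both laws are concentrated on (0,1), so agreement of their CDFs there
  makes them equal (\<open>real_distribution_eq_on_unit_interval\<close>). The second identity is
  the first one pushed forward along g, because g(h(Y)) = Y almost surely
  (\<open>transform_inverse\<close>). No joint law of W and Y enters, so they may live on different
  probability spaces.\<close>

lemma real_distribution_eq_on_unit_interval:
  assumes "real_distribution D" "real_distribution E"
    and "AE w in D. 0 < w \<and> w < 1" "AE w in E. 0 < w \<and> w < 1"
    and eq: "\<And>w. 0 < w \<Longrightarrow> w < 1 \<Longrightarrow> cdf D w = cdf E w"
  shows "D = E"
proof (rule cdf_unique)
  \<comment> \<open>Concentration on (0,1) forces the CDF to be 0 up to and including 0, and 1 from
    1 onwards, so only the open interval has to be compared.\<close>
  have low: "cdf F w = 0"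
    if "real_distribution F" "AE w in F. 0 < w \<and> w < 1" "w \<le> 0" for F w
  proof -
    interpret real_distribution F by fact
    have "AE x in F. x \<notin> {..w}"
      using that(2) by eventually_elim (use that(3) in auto)
    then show ?thesis
      by (simp add: cdf_def prob_eq_0)
  qed
  have high: "cdf F w = 1"
    if "real_distribution F" "AE w in F. 0 < w \<and> w < 1" "1 \<le> w" for F w
  proof -
    interpret real_distribution F by fact
    have "AE x in F. x \<in> {..w}"
      using that(2) by eventually_elim (use that(3) in auto)
    then show ?thesis
      by (simp add: cdf_def prob_eq_1)
  qed
  show "cdf D = cdf E"
  proof
    fix w :: real
    consider "w \<le> 0" | "0 < w" "w < 1" | "1 \<le> w"
      by linarith
    then show "cdf D w = cdf E w"
      using assms low high by cases auto
  qed
qed fact+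

text \<open>The scale \<sigma> can be moved inside the power since s = w / (1 - w) and \<sigma> are
  positive; the quantity \<open>t\<close> of \<open>UF_cdf\<close> is then the argument given to
  \<open>G_cdf\<close>.\<close>

lemma UF_cdf_eq_G_cdf:
  assumes "0 < \<sigma>" "0 < w" "w < 1"
  shows "UF_cdf \<sigma> \<alpha> \<rho> w = G_cdf \<rho> ((w / (\<sigma> * (1 - w))) powr \<alpha>)"
proof -
  have "(w / (1 - w)) powr \<alpha> / \<sigma> powr \<alpha> = (w / (\<sigma> * (1 - w))) powr \<alpha>"
    using assms by (simp add: powr_divide powr_mult)
  then show ?thesis
    unfolding UF_cdf_def G_cdf_def Let_def by simp
qed

text \<open>With z = y^(1/\<alpha>), clearing the positive denominator makes the inequality linear
  in z; it is solved for z using 1 - w > 0, and raising to the power \<alpha> recovers y.\<close>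

lemma transform_le_iff:
  fixes \<sigma> \<alpha> y w :: real
  assumes "0 < \<sigma>" "0 < \<alpha>" "0 < y" "0 < w" "w < 1"
  shows "\<sigma> * y powr (1 / \<alpha>) / (1 + \<sigma> * y powr (1 / \<alpha>)) \<le> w \<longleftrightarrow>
         y \<le> (w / (\<sigma> * (1 - w))) powr \<alpha>"
proof -
  define z where "z = y powr (1 / \<alpha>)"
  have z: "0 < z" "z powr \<alpha> = y"
    using assms by (auto simp: z_def powr_powr)
  have pos: "0 < 1 + \<sigma> * z"
    using assms z by (simp add: add_pos_pos)
  have "\<sigma> * z / (1 + \<sigma> * z) \<le> w \<longleftrightarrow> \<sigma> * z \<le> w * (1 + \<sigma> * z)"
    using pos by (simp add: pos_divide_le_eq)
  also have "\<dots> \<longleftrightarrow> z * (\<sigma> * (1 - w)) \<le> w"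
    by (simp add: algebra_simps)
  also have "\<dots> \<longleftrightarrow> z \<le> w / (\<sigma> * (1 - w))"
    using assms by (simp add: pos_le_divide_eq)
  \<comment> \<open>Both bases are positive and \<alpha> > 0, so the power is strictly increasing:
    monotonicity gives one direction, strictness the other.\<close>
  also have "\<dots> \<longleftrightarrow> z powr \<alpha> \<le> (w / (\<sigma> * (1 - w))) powr \<alpha>"
    by (smt (verit) assms z divide_pos_pos mult_pos_pos powr_less_mono2 powr_mono2)
  finally show ?thesis
    using z by (simp add: z_def)
qed

text \<open>The odds w / (1 - w) of the transformed value are exactly \<sigma>
  y^(1/\<alpha>).\<close>

lemma transform_inverse:
  fixes \<sigma> \<alpha> y :: real
  assumes "0 < \<sigma>" "0 < \<alpha>" "0 < y"
  defines "w \<equiv> \<sigma> * y powr (1 / \<alpha>) / (1 + \<sigma> * y powr (1 / \<alpha>))"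
  shows "(w / (\<sigma> * (1 - w))) powr \<alpha> = y"
proof -
  have pos: "0 < 1 + \<sigma> * y powr (1 / \<alpha>)"
    using assms by (simp add: add_pos_nonneg)
  then have "1 - w = 1 / (1 + \<sigma> * y powr (1 / \<alpha>))"
    by (simp add: w_def field_simps)
  then have "w / (\<sigma> * (1 - w)) = y powr (1 / \<alpha>)"
    using assms(1) pos by (simp add: w_def)
  then show ?thesis
    using assms(2,3) by (simp add: powr_powr)
qed

theorem mainTheorem5:
  fixes \<sigma> \<alpha> \<rho> :: real
    and M :: "'a measure" and W :: "'a \<Rightarrow> real"
    and N :: "'b measure" and Y :: "'b \<Rightarrow> real"
  assumes "\<sigma> > 0" and "\<alpha> > 0" and "0 \<le> \<rho>" and "\<rho> \<le> 1"
    and "prob_space M" and "W \<in> borel_measurable M"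
    and "UF_distribution \<sigma> \<alpha> \<rho> (distr M borel W)"
    and "prob_space N" and "Y \<in> borel_measurable N"
    and "AE \<omega> in N. Y \<omega> > 0"
    and "\<And>x. x > 0 \<Longrightarrow> cdf (distr N borel Y) x = G_cdf \<rho> x"
  shows "distr M borel W =
           distr N borel (\<lambda>\<omega>. \<sigma> * Y \<omega> powr (1 / \<alpha>) / (1 + \<sigma> * Y \<omega> powr (1 / \<alpha>))) \<and>
         distr N borel Y =
           distr M borel (\<lambda>\<omega>. (W \<omega> / (\<sigma> * (1 - W \<omega>))) powr \<alpha>)"
proof
  note [measurable] = \<open>W \<in> borel_measurable M\<close> \<open>Y \<in> borel_measurable N\<close>
  interpret N: prob_space N by fact
  define Z where "Z \<omega> = \<sigma> * Y \<omega> powr (1 / \<alpha>) / (1 + \<sigma> * Y \<omega> powr (1 / \<alpha>))" for \<omega>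
  have [measurable]: "Z \<in> borel_measurable N"
    unfolding Z_def by measurable
  define g where "g w = (w / (\<sigma> * (1 - w))) powr \<alpha>" for w
  have [measurable]: "g \<in> borel_measurable borel"
    unfolding g_def by measurable

  have W_Z: "distr M borel W = distr N borel Z"
  proof (rule real_distribution_eq_on_unit_interval)
    show "real_distribution (distr M borel W)" "AE w in distr M borel W. 0 < w \<and> w < 1"
      using assms(7) by (auto simp: UF_distribution_def)
    show "real_distribution (distr N borel Z)"
      by (rule N.real_distribution_distr) measurable
    have "AE \<omega> in N. 0 < Z \<omega> \<and> Z \<omega> < 1"
      using assms(10)
    proof eventually_elim
      case (elim \<omega>)
      then have "0 < \<sigma> * Y \<omega> powr (1 / \<alpha>)"
        using assms(1) by simp
      then show ?case
        by (simp add: Z_def)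
    qed
    then show "AE w in distr N borel Z. 0 < w \<and> w < 1"
      by (subst AE_distr_iff) measurable
    fix w :: real
    assume w: "0 < w" "w < 1"
    \<comment> \<open>The CDF of \<open>Y\<close> is prescribed only at positive arguments.\<close>
    have "0 < g w"
      using w assms(1) by (simp add: g_def)
    have "cdf (distr M borel W) w = G_cdf \<rho> (g w)"
      using assms(1,7) w by (simp add: UF_distribution_def UF_cdf_eq_G_cdf g_def)
    also have "\<dots> = cdf (distr N borel Y) (g w)"
      using assms(11) \<open>0 < g w\<close> by simp
    also have "\<dots> = measure N {\<omega> \<in> space N. Y \<omega> \<le> g w}"
      by (simp add: cdf_def measure_distr vimage_def Int_def conj_commute)
    \<comment> \<open>The equivalence of the two inequalities requires \<open>Y\<close> to be
      positive, which holds only almost surely, so the events are matched up to a null set.\<close>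
    also have "\<dots> = measure N {\<omega> \<in> space N. Z \<omega> \<le> w}"
    proof (rule N.finite_measure_eq_AE)
      show "AE \<omega> in N. \<omega> \<in> {\<omega> \<in> space N. Y \<omega> \<le> g w} \<longleftrightarrow> \<omega> \<in> {\<omega> \<in> space N. Z \<omega> \<le> w}"
        using assms(10)
        by eventually_elim
          (use assms(1,2) w in \<open>simp add: Z_def g_def transform_le_iff\<close>)
    qed measurable
    also have "\<dots> = cdf (distr N borel Z) w"
      by (simp add: cdf_def measure_distr vimage_def Int_def conj_commute)
    finally show "cdf (distr M borel W) w = cdf (distr N borel Z) w" .
  qed
  then show "distr M borel W =
      distr N borel (\<lambda>\<omega>. \<sigma> * Y \<omega> powr (1 / \<alpha>) / (1 + \<sigma> * Y \<omega> powr (1 / \<alpha>)))"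
    by (simp add: Z_def[abs_def])

  \<comment> \<open>As \<open>g\<close> is Borel on the whole line, the equality of laws
    \<open>W_Z\<close> can be transported along it without any new CDF computation.\<close>
  have "distr N borel Y = distr N borel (g \<circ> Z)"
  proof (rule distr_cong_AE)
    show "AE \<omega> in N. Y \<omega> = (g \<circ> Z) \<omega>"
      using assms(10)
      by eventually_elim
        (use assms(1,2) in \<open>simp only: Z_def g_def comp_apply transform_inverse\<close>)
  qed (auto simp: comp_def)
  also have "\<dots> = distr (distr N borel Z) borel g"
    by (simp add: distr_distr)
  also have "\<dots> = distr (distr M borel W) borel g"
    by (simp only: W_Z)
  also have "\<dots> = distr M borel (g \<circ> W)"
    by (simp add: distr_distr)
  finally show "distr N borel Y = distr M borel (\<lambda>\<omega>. (W \<omega> / (\<sigma> * (1 - W \<omega>))) powr \<alpha>)"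
    by (simp add: g_def comp_def)
qed

end
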